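(* Let $\mathsf{C}$ be a category, $\Phi$ a Riguet congruence on $\mathsf{C}$ and $F$ a functor from $\mathsf{C}$ to a category $\mathsf{D}$ such that (1) for all $a,a'\in\mathrm{Ob}(\mathsf{C})$, if $(a,a')\in\Phi^{\mathrm{ob}}$, then $F(a)=F(a')$, and (2) for all $f\colon a\to b$ and $f'\colon a'\to b'$ in $\mathsf{C}$, if $(f,f')\in\Phi^{\mathrm{fl}}_{\left(\begin{smallmatrix}a&b\\ a'&b'\end{smallmatrix}\right)}$, then $F(f)=F(f')$. Then there exists a unique functor $F^{\sharp}$ from the Riguet quotient $\mathsf{C}/\Phi$ to $\mathsf{D}$ such that $F^{\sharp}\circ P_{\Phi}=F$, where $P_\Phi\colon\mathsf{C}\to\mathsf{C}/\Phi$ is the canonical projection.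
   Context: Hom-sets of a category are assumed pairwise disjoint. A Riguet congruence on a category $\mathsf{C}$ is a pair $\Phi=(\Phi^{\mathrm{ob}},\Phi^{\mathrm{fl}})$ where $\Phi^{\mathrm{ob}}$ is an equivalence relation on $\mathrm{Ob}(\mathsf{C})$ and $\Phi^{\mathrm{fl}}$ assigns to all $(a,a'),(b,b')\in\Phi^{\mathrm{ob}}$ a subset $\Phi^{\mathrm{fl}}_{\left(\begin{smallmatrix}a&b\\ a'&b'\end{smallmatrix}\right)}\subseteq\mathrm{Hom}_{\mathsf{C}}(a,b)\times\mathrm{Hom}_{\mathsf{C}}(a',b')$ such that: (a) if $(a,b)\in\Phi^{\mathrm{ob}}$, then $(\mathrm{id}_a,\mathrm{id}_b)\in\Phi^{\mathrm{fl}}_{\left(\begin{smallmatrix}a&a\\ b&b\end{smallmatrix}\right)}$; (b) if $f\in\mathrm{Hom}_{\mathsf{C}}(a,b)$, then $(f,f)\in\Phi^{\mathrm{fl}}_{\left(\begin{smallmatrix}a&b\\ a&b\end{smallmatrix}\right)}$; (c) if $(f,f')\in\Phi^{\mathrm{fl}}_{\left(\begin{smallmatrix}a&b\\ a'&b'\end{smallmatrix}\right)}$, then $(f',f)\in\Phi^{\mathrm{fl}}_{\left(\begin{smallmatrix}a'&b'\\ a&b\end{smallmatrix}\right)}$; (d) if $(f,f')\in\Phi^{\mathrm{fl}}_{\left(\begin{smallmatrix}a&b\\ a'&b'\end{smallmatrix}\right)}$ and $(f',f'')\in\Phi^{\mathrm{fl}}_{\left(\begin{smallmatrix}a'&b'\\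 a''&b''\end{smallmatrix}\right)}$, then $(f,f'')\in\Phi^{\mathrm{fl}}_{\left(\begin{smallmatrix}a&b\\ a''&b''\end{smallmatrix}\right)}$; (e) if $(f,f')\in\Phi^{\mathrm{fl}}_{\left(\begin{smallmatrix}a&b\\ a'&b'\end{smallmatrix}\right)}$ and $(g,g')\in\Phi^{\mathrm{fl}}_{\left(\begin{smallmatrix}b&c\\ b'&c'\end{smallmatrix}\right)}$, then $(g\circ f,g'\circ f')\in\Phi^{\mathrm{fl}}_{\left(\begin{smallmatrix}a&c\\ a'&c'\end{smallmatrix}\right)}$; (f) for all $(a,a'),(b,b')\in\Phi^{\mathrm{ob}}$ and $f\in\mathrm{Hom}_{\mathsf{C}}(a,b)$ there is $f'\in\mathrm{Hom}_{\mathsf{C}}(a',b')$ with $(f,f')\in\Phi^{\mathrm{fl}}_{\left(\begin{smallmatrix}a&b\\ a'&b'\end{smallmatrix}\right)}$. The Riguet quotient $\mathsf{C}/\Phi$ is the category whose objects are the $\Phi^{\mathrm{ob}}$-classes $[a]$ of objects of $\mathsf{C}$; whose morphisms from $[a]$ to $[b]$ are the classes $[f]$ of elements $f$ of $\bigcup_{a'\in[a],b'\in[b]}\mathrm{Hom}_{\mathsf{C}}(a',b')$ under the equivalence relation $\bigcup_{a',a''\in[a];\,b',b''\in[b]}\Phi^{\mathrm{fl}}_{\left(\begin{smallmatrix}a'&b'\\ a''&b''\end{smallmatrix}\right)}$; whose identity at $[a]$ is $[\mathrm{id}_a]$; and where, for $f\colon a'\to b'$ and $g\colon b''\to c'$ with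 $(b',b'')\in\Phi^{\mathrm{ob}}$, $[g]\circ[f]=[g\circ h]$ for any $h\colon a'\to b''$ with $(f,h)\in\Phi^{\mathrm{fl}}_{\left(\begin{smallmatrix}a'&b'\\ a'&b''\end{smallmatrix}\right)}$ (such $h$ exists by (f)). The canonical projection $P_\Phi\colon\mathsf{C}\to\mathsf{C}/\Phi$ is $a\mapsto[a]$, $f\mapsto[f]$. *)

theory Defs
  imports Main "HOL-Library.FuncSet"
begin

section \<open>Categories and functors\<close>

text \<open>
  Categories are carrier-based: \<open>Hom C a b\<close> is meaningful only for objects \<open>a\<close>, \<open>b\<close>, and nothing is
  assumed about the values of the fields elsewhere. As hom-sets are pairwise disjoint, composition
  needs no object indices; \<open>Comp C g f\<close> is \<open>g \<circ> f\<close>.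
\<close>

record ('o, 'm) cat =
  Ob :: "'o set"
  Hom :: "'o \<Rightarrow> 'o \<Rightarrow> 'm set"
  Ident :: "'o \<Rightarrow> 'm"
  Comp :: "'m \<Rightarrow> 'm \<Rightarrow> 'm"

definition Arr :: "('o, 'm) cat \<Rightarrow> 'm set" where
  "Arr C = (\<Union>a\<in>Ob C. \<Union>b\<in>Ob C. Hom C a b)"

locale category =
  fixes C :: "('o, 'm) cat"
  assumes Hom_disjoint:
      "\<lbrakk>a \<in> Ob C; b \<in> Ob C; a' \<in> Ob C; b' \<in> Ob C; (a, b) \<noteq> (a', b')\<rbrakk>
        \<Longrightarrow> Hom C a b \<inter> Hom C a' b' = {}"
    and Ident_in_Hom: "a \<in> Ob C \<Longrightarrow> Ident C a \<in> Hom C a a"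
    and Comp_in_Hom:
      "\<lbrakk>a \<in> Ob C; b \<in> Ob C; c \<in> Ob C; f \<in> Hom C a b; g \<in> Hom C b c\<rbrakk> \<Longrightarrow> Comp C g f \<in> Hom C a c"
    and Comp_Ident: "\<lbrakk>a \<in> Ob C; b \<in> Ob C; f \<in> Hom C a b\<rbrakk> \<Longrightarrow> Comp C f (Ident C a) = f"
    and Ident_Comp: "\<lbrakk>a \<in> Ob C; b \<in> Ob C; f \<in> Hom C a b\<rbrakk> \<Longrightarrow> Comp C (Ident C b) f = f"
    and Comp_assoc:
      "\<lbrakk>a \<in> Ob C; b \<in> Ob C; c \<in> Ob C; d \<in> Ob C; f \<in> Hom C a b; g \<in> Hom C b c; h \<in> Hom C c d\<rbrakk>
        \<Longrightarrow> Comp C h (Comp C g f) = Comp C (Comp C h g) f"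

record ('o1, 'm1, 'o2, 'm2) cat_map =
  onOb :: "'o1 \<Rightarrow> 'o2"
  onArr :: "'m1 \<Rightarrow> 'm2"

text \<open>
  The two maps of a functor are extensional (\<open>undefined\<close> outside the objects, respectively arrows, of
  the source), so that HOL equality of functors with given source and target is equality of functors.
\<close>

locale cat_functor = source: category C + target: category D
  for C :: "('o1, 'm1) cat" and D :: "('o2, 'm2) cat" +
  fixes F :: "('o1, 'm1, 'o2, 'm2) cat_map"
  assumes onOb_funcset: "onOb F \<in> Ob C \<rightarrow>\<^sub>E Ob D"
    and onArr_extensional: "onArr F \<in> extensional (Arr C)"
    and onArr_in_Hom:
      "\<lbrakk>a \<in> Ob C; b \<in> Ob C; f \<in> Hom C a b\<rbrakk> \<Longrightarrow> onArr F f \<in> Hom D (onOb F a) (onOb F b)"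
    and onArr_Ident: "a \<in> Ob C \<Longrightarrow> onArr F (Ident C a) = Ident D (onOb F a)"
    and onArr_Comp:
      "\<lbrakk>a \<in> Ob C; b \<in> Ob C; c \<in> Ob C; f \<in> Hom C a b; g \<in> Hom C b c\<rbrakk>
        \<Longrightarrow> onArr F (Comp C g f) = Comp D (onArr F g) (onArr F f)"

text \<open>\<open>functor_comp C G F\<close> is \<open>G \<circ> F\<close>, where \<open>C\<close> is the source of \<open>F\<close>.\<close>

definition functor_comp ::
  "('o1, 'm1) cat \<Rightarrow> ('o2, 'm2, 'o3, 'm3) cat_map \<Rightarrow> ('o1, 'm1, 'o2, 'm2) cat_map
    \<Rightarrow> ('o1, 'm1, 'o3, 'm3) cat_map" where
  "functor_comp C G F =
    \<lparr>onOb = compose (Ob C) (onOb G) (onOb F), onArr = compose (Arr C) (onArr G) (onArr F)\<rparr>"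


section \<open>Riguet congruences\<close>

text \<open>
  \<open>fl \<Phi> a b a' b'\<close> is the relation between \<open>Hom C a b\<close> and \<open>Hom C a' b'\<close>; it is meaningful only if
  \<open>(a, a')\<close> and \<open>(b, b')\<close> are in \<open>ob \<Phi>\<close>.
\<close>

record ('o, 'm) cat_cong =
  ob :: "('o \<times> 'o) set"
  fl :: "'o \<Rightarrow> 'o \<Rightarrow> 'o \<Rightarrow> 'o \<Rightarrow> ('m \<times> 'm) set"

locale riguet_congruence = category C
  for C :: "('o, 'm) cat" +
  fixes \<Phi> :: "('o, 'm) cat_cong"
  assumes ob_equiv: "equiv (Ob C) (ob \<Phi>)"
    and fl_subset:
      "\<lbrakk>(a, a') \<in> ob \<Phi>; (b, b') \<in> ob \<Phi>\<rbrakk> \<Longrightarrow> fl \<Phi> a b a' b' \<subseteq> Hom C a b \<times> Hom C a' b'"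
    and fl_Ident: "(a, b) \<in> ob \<Phi> \<Longrightarrow> (Ident C a, Ident C b) \<in> fl \<Phi> a a b b"
    and fl_refl: "\<lbrakk>a \<in> Ob C; b \<in> Ob C; f \<in> Hom C a b\<rbrakk> \<Longrightarrow> (f, f) \<in> fl \<Phi> a b a b"
    and fl_sym:
      "\<lbrakk>(a, a') \<in> ob \<Phi>; (b, b') \<in> ob \<Phi>; (f, f') \<in> fl \<Phi> a b a' b'\<rbrakk> \<Longrightarrow> (f', f) \<in> fl \<Phi> a' b' a b"
    and fl_trans:
      "\<lbrakk>(a, a') \<in> ob \<Phi>; (b, b') \<in> ob \<Phi>; (a', a'') \<in> ob \<Phi>; (b', b'') \<in> ob \<Phi>;
        (f, f') \<in> fl \<Phi> a b a' b'; (f', f'') \<in> fl \<Phi> a' b' a'' b''\<rbrakk> \<Longrightarrow> (f, f'') \<in> fl \<Phi> a b a'' b''"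
    and fl_Comp:
      "\<lbrakk>(a, a') \<in> ob \<Phi>; (b, b') \<in> ob \<Phi>; (c, c') \<in> ob \<Phi>;
        (f, f') \<in> fl \<Phi> a b a' b'; (g, g') \<in> fl \<Phi> b c b' c'\<rbrakk>
        \<Longrightarrow> (Comp C g f, Comp C g' f') \<in> fl \<Phi> a c a' c'"
    and fl_lift:
      "\<lbrakk>(a, a') \<in> ob \<Phi>; (b, b') \<in> ob \<Phi>; f \<in> Hom C a b\<rbrakk>
        \<Longrightarrow> \<exists>f'\<in>Hom C a' b'. (f, f') \<in> fl \<Phi> a b a' b'"


section \<open>The Riguet quotient\<close>

definition ob_class :: "('o, 'm) cat_cong \<Rightarrow> 'o \<Rightarrow> 'o set" where
  "ob_class \<Phi> a = ob \<Phi> `` {a}"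

definition fl_between :: "('o, 'm) cat_cong \<Rightarrow> 'o set \<Rightarrow> 'o set \<Rightarrow> ('m \<times> 'm) set" where
  "fl_between \<Phi> A B = (\<Union>a'\<in>A. \<Union>a''\<in>A. \<Union>b'\<in>B. \<Union>b''\<in>B. fl \<Phi> a' b' a'' b'')"

definition Hom_between :: "('o, 'm) cat \<Rightarrow> 'o set \<Rightarrow> 'o set \<Rightarrow> 'm set" where
  "Hom_between C A B = (\<Union>a'\<in>A. \<Union>b'\<in>B. Hom C a' b')"

text \<open>
  The class \<open>[f]\<close> of an arrow, with source and target left implicit: by disjointness of hom-sets it is
  the class under \<open>fl_between \<Phi> [a] [b]\<close> for any \<open>a\<close>, \<open>b\<close> with \<open>f \<in> Hom C a b\<close>
  (lemma \<open>fl_class_eq\<close> below).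
\<close>

definition fl_class :: "('o, 'm) cat_cong \<Rightarrow> 'm \<Rightarrow> 'm set" where
  "fl_class \<Phi> f = (\<Union>(a, a')\<in>ob \<Phi>. \<Union>(b, b')\<in>ob \<Phi>. fl \<Phi> a b a' b') `` {f}"

definition quot_Ident :: "('o, 'm) cat \<Rightarrow> ('o, 'm) cat_cong \<Rightarrow> 'o set \<Rightarrow> 'm set" where
  "quot_Ident C \<Phi> A = (THE X. \<exists>a\<in>Ob C. A = ob_class \<Phi> a \<and> X = fl_class \<Phi> (Ident C a))"

text \<open>The descriptions here and in \<open>quot_Ident\<close> do not depend on representatives: see
  \<open>quot_Ident_class\<close> and \<open>quot_Comp_class\<close>.\<close>

definition quot_Comp :: "('o, 'm) cat \<Rightarrow> ('o, 'm) cat_cong \<Rightarrow> 'm set \<Rightarrow> 'm set \<Rightarrow> 'm set" where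
  "quot_Comp C \<Phi> G F =
    (THE X. \<exists>a' b' b'' c' f g h.
      a' \<in> Ob C \<and> c' \<in> Ob C \<and> (b', b'') \<in> ob \<Phi> \<and>
      f \<in> Hom C a' b' \<and> g \<in> Hom C b'' c' \<and> F = fl_class \<Phi> f \<and> G = fl_class \<Phi> g \<and>
      h \<in> Hom C a' b'' \<and> (f, h) \<in> fl \<Phi> a' b' a' b'' \<and> X = fl_class \<Phi> (Comp C g h))"

definition riguet_quotient ::
  "('o, 'm) cat \<Rightarrow> ('o, 'm) cat_cong \<Rightarrow> ('o set, 'm set) cat" where
  "riguet_quotient C \<Phi> =
    \<lparr>Ob = Ob C // ob \<Phi>,
     Hom = (\<lambda>A B. Hom_between C A B // fl_between \<Phi> A B),
     Ident = quot_Ident C \<Phi>,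
     Comp = quot_Comp C \<Phi>\<rparr>"

definition riguet_proj ::
  "('o, 'm) cat \<Rightarrow> ('o, 'm) cat_cong \<Rightarrow> ('o, 'm, 'o set, 'm set) cat_map" where
  "riguet_proj C \<Phi> = \<lparr>onOb = restrict (ob_class \<Phi>) (Ob C), onArr = restrict (fl_class \<Phi>) (Arr C)\<rparr>"

context riguet_congruence
begin

lemma ob_Ob: "(a, b) \<in> ob \<Phi> \<Longrightarrow> a \<in> Ob C" "(a, b) \<in> ob \<Phi> \<Longrightarrow> b \<in> Ob C"
  using ob_equiv by (auto simp: equiv_def)

lemma ob_refl: "a \<in> Ob C \<Longrightarrow> (a, a) \<in> ob \<Phi>"
  using ob_equiv by (auto simp: equiv_def refl_on_def)

lemma ob_sym: "(a, b) \<in> ob \<Phi> \<Longrightarrow> (b, a) \<in> ob \<Phi>"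
  using ob_equiv by (auto simp: equiv_def sym_def)

lemma ob_trans: "(a, b) \<in> ob \<Phi> \<Longrightarrow> (b, c) \<in> ob \<Phi> \<Longrightarrow> (a, c) \<in> ob \<Phi>"
  using ob_equiv by (auto simp: equiv_def trans_def)

lemma Hom_unique:
  "\<lbrakk>a \<in> Ob C; b \<in> Ob C; a' \<in> Ob C; b' \<in> Ob C; f \<in> Hom C a b; f \<in> Hom C a' b'\<rbrakk>
    \<Longrightarrow> a' = a \<and> b' = b"
  using Hom_disjoint[of a b a' b'] by blast

lemma fl_class_iff:
  assumes "a \<in> Ob C" "b \<in> Ob C" "f \<in> Hom C a b"
  shows "f' \<in> fl_class \<Phi> f \<longleftrightarrow>
    (\<exists>a' b'. (a, a') \<in> ob \<Phi> \<and> (b, b') \<in> ob \<Phi> \<and> (f, f') \<in> fl \<Phi> a b a' b')"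
proof
  assume "f' \<in> fl_class \<Phi> f"
  then obtain c c' d d' where *: "(c, c') \<in> ob \<Phi>" "(d, d') \<in> ob \<Phi>" "(f, f') \<in> fl \<Phi> c d c' d'"
    by (auto simp: fl_class_def)
  then have "f \<in> Hom C c d" using fl_subset by blast
  then have "c = a \<and> d = b" using Hom_unique[of a b c d f] assms ob_Ob * by blast
  then show "\<exists>a' b'. (a, a') \<in> ob \<Phi> \<and> (b, b') \<in> ob \<Phi> \<and> (f, f') \<in> fl \<Phi> a b a' b'"
    using * by blast
qed (auto simp: fl_class_def)

lemma fl_class_eq:
  assumes "a \<in> Ob C" "b \<in> Ob C" "f \<in> Hom C a b"
  shows "fl_class \<Phi> f = fl_between \<Phi> (ob_class \<Phi> a) (ob_class \<Phi> b) `` {f}"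
proof (rule set_eqI)
  fix f'
  show "f' \<in> fl_class \<Phi> f \<longleftrightarrow> f' \<in> fl_between \<Phi> (ob_class \<Phi> a) (ob_class \<Phi> b) `` {f}"
  proof
    assume "f' \<in> fl_class \<Phi> f"
    then show "f' \<in> fl_between \<Phi> (ob_class \<Phi> a) (ob_class \<Phi> b) `` {f}"
      using fl_class_iff[OF assms] ob_refl assms by (fastforce simp: fl_between_def ob_class_def)
  next
    assume "f' \<in> fl_between \<Phi> (ob_class \<Phi> a) (ob_class \<Phi> b) `` {f}"
    then obtain c c' d d' where *: "(a, c) \<in> ob \<Phi>" "(a, c') \<in> ob \<Phi>" "(b, d) \<in> ob \<Phi>"
      "(b, d') \<in> ob \<Phi>" "(f, f') \<in> fl \<Phi> c d c' d'"
      by (auto simp: fl_between_def ob_class_def)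
    then have "(c, c') \<in> ob \<Phi>" "(d, d') \<in> ob \<Phi>"
      using ob_sym ob_trans by blast+
    then show "f' \<in> fl_class \<Phi> f" using * by (auto simp: fl_class_def)
  qed
qed

lemma fl_class_eq_iff:
  assumes "a \<in> Ob C" "b \<in> Ob C" "f \<in> Hom C a b" "a' \<in> Ob C" "b' \<in> Ob C" "f' \<in> Hom C a' b'"
  shows "fl_class \<Phi> f = fl_class \<Phi> f' \<longleftrightarrow>
    (a, a') \<in> ob \<Phi> \<and> (b, b') \<in> ob \<Phi> \<and> (f, f') \<in> fl \<Phi> a b a' b'"
proof
  assume "fl_class \<Phi> f = fl_class \<Phi> f'"
  moreover have "f' \<in> fl_class \<Phi> f'"
    using fl_class_iff[OF assms(4-6)] ob_refl fl_refl assms by blast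
  ultimately obtain c d where *: "(a, c) \<in> ob \<Phi>" "(b, d) \<in> ob \<Phi>" "(f, f') \<in> fl \<Phi> a b c d"
    using fl_class_iff[OF assms(1-3)] by blast
  then have "f' \<in> Hom C c d" using fl_subset by blast
  then have "c = a' \<and> d = b'" using Hom_unique[of a' b' c d f'] assms ob_Ob * by blast
  then show "(a, a') \<in> ob \<Phi> \<and> (b, b') \<in> ob \<Phi> \<and> (f, f') \<in> fl \<Phi> a b a' b'"
    using * by blast
next
  assume *: "(a, a') \<in> ob \<Phi> \<and> (b, b') \<in> ob \<Phi> \<and> (f, f') \<in> fl \<Phi> a b a' b'"
  then have **: "(a', a) \<in> ob \<Phi>" "(b', b) \<in> ob \<Phi>" "(f', f) \<in> fl \<Phi> a' b' a b"
    using ob_sym fl_sym by blast+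
  show "fl_class \<Phi> f = fl_class \<Phi> f'"
  proof (rule set_eqI)
    fix k
    show "k \<in> fl_class \<Phi> f \<longleftrightarrow> k \<in> fl_class \<Phi> f'"
      unfolding fl_class_iff[OF assms(1-3)] fl_class_iff[OF assms(4-6)]
      using * ** ob_trans fl_trans by meson
  qed
qed

lemma quot_Ident_class:
  assumes "a \<in> Ob C"
  shows "quot_Ident C \<Phi> (ob_class \<Phi> a) = fl_class \<Phi> (Ident C a)"
  unfolding quot_Ident_def
proof (rule the_equality)
  fix X assume "\<exists>b\<in>Ob C. ob_class \<Phi> a = ob_class \<Phi> b \<and> X = fl_class \<Phi> (Ident C b)"
  then obtain b where b: "b \<in> Ob C" "ob_class \<Phi> a = ob_class \<Phi> b" "X = fl_class \<Phi> (Ident C b)"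
    by blast
  then have "(a, b) \<in> ob \<Phi>" using ob_equiv assms by (auto simp: ob_class_def eq_equiv_class_iff)
  then show "X = fl_class \<Phi> (Ident C a)"
    using fl_class_eq_iff[of a a "Ident C a" b b "Ident C b"] Ident_in_Hom fl_Ident assms b by metis
qed (use assms in blast)

lemma quot_Comp_class:
  assumes "a' \<in> Ob C" "c' \<in> Ob C" "(b', b'') \<in> ob \<Phi>" "f \<in> Hom C a' b'" "g \<in> Hom C b'' c'"
    "h \<in> Hom C a' b''" "(f, h) \<in> fl \<Phi> a' b' a' b''"
  shows "quot_Comp C \<Phi> (fl_class \<Phi> g) (fl_class \<Phi> f) = fl_class \<Phi> (Comp C g h)"
  unfolding quot_Comp_def
proof (rule the_equality)
  fix X
  assume "\<exists>p q q' r f1 g1 h1. p \<in> Ob C \<and> r \<in> Ob C \<and> (q, q') \<in> ob \<Phi> \<and>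
      f1 \<in> Hom C p q \<and> g1 \<in> Hom C q' r \<and> fl_class \<Phi> f = fl_class \<Phi> f1 \<and>
      fl_class \<Phi> g = fl_class \<Phi> g1 \<and>
      h1 \<in> Hom C p q' \<and> (f1, h1) \<in> fl \<Phi> p q p q' \<and> X = fl_class \<Phi> (Comp C g1 h1)"
  then obtain p q q' r f1 g1 h1 where
    1: "p \<in> Ob C" "r \<in> Ob C" "(q, q') \<in> ob \<Phi>" "f1 \<in> Hom C p q" "g1 \<in> Hom C q' r"
      "fl_class \<Phi> f = fl_class \<Phi> f1" "fl_class \<Phi> g = fl_class \<Phi> g1"
      "h1 \<in> Hom C p q'" "(f1, h1) \<in> fl \<Phi> p q p q'" "X = fl_class \<Phi> (Comp C g1 h1)"
    by blast
  note Obs = ob_Ob[OF assms(3)] ob_Ob[OF 1(3)] assms(1,2) 1(1,2)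
  have f: "(a', p) \<in> ob \<Phi>" "(b', q) \<in> ob \<Phi>" "(f, f1) \<in> fl \<Phi> a' b' p q"
    using fl_class_eq_iff[of a' b' f p q f1] Obs assms 1 by blast+
  have g: "(b'', q') \<in> ob \<Phi>" "(c', r) \<in> ob \<Phi>" "(g, g1) \<in> fl \<Phi> b'' c' q' r"
    using fl_class_eq_iff[of b'' c' g q' r g1] Obs assms 1 by blast+
  have "(h, f) \<in> fl \<Phi> a' b'' a' b'"
    using fl_sym ob_refl assms by blast
  then have "(h, f1) \<in> fl \<Phi> a' b'' p q"
    using fl_trans[of a' a' b'' b' p q h f f1] f ob_refl ob_sym assms by blast
  moreover have "(b'', q) \<in> ob \<Phi>"
    using ob_sym ob_trans assms f by blast
  ultimately have "(h, h1) \<in> fl \<Phi> a' b'' p q'"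
    using fl_trans[of a' p b'' q p q' h f1 h1] f ob_refl 1 by blast
  then have "(Comp C g h, Comp C g1 h1) \<in> fl \<Phi> a' c' p r"
    using fl_Comp[of a' p b'' q' c' r] f g by blast
  moreover have "Comp C g h \<in> Hom C a' c'" "Comp C g1 h1 \<in> Hom C p r"
    using Comp_in_Hom Obs assms 1 by blast+
  ultimately show "X = fl_class \<Phi> (Comp C g h)"
    using fl_class_eq_iff[of a' c' "Comp C g h" p r "Comp C g1 h1"] Obs f g 1 by metis
qed (use assms in blast)

end

end

theory Submission
  imports Defs
begin

text \<open>
  The idea is that the lifting axiom of a congruence lets the source and target representatives be
  chosen before those of the arrows: every arrow \<open>[a] \<rightarrow> [b]\<close> of the quotient is \<open>[f]\<close> for some \<open>f\<close> from \<open>a\<close> to \<open>b\<close>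
  themselves (\<open>Hom_quotient\<close>). A diagram in the quotient of the shapes occurring in the category and
  functor laws therefore lifts to a diagram of the same shape in \<open>C\<close>, where composable classes have
  composable representatives and \<open>[g] \<circ> [f]\<close> is simply \<open>[g \<circ> f]\<close> (\<open>Comp_quotient\<close>).
  So the laws of the quotient are the images of those of \<open>C\<close>.

  The hypotheses on \<open>F\<close> say that it is constant on the classes of objects and of arrows, so it
  induces maps on classes, and by the lifting of diagrams these inherit the functor laws from \<open>F\<close>.
  The projection is onto, on objects and on arrows, which leaves no choice for the values of a
  factorization; outside the quotient its maps are fixed by extensionality.
\<close>

section \<open>The quotient category\<close>

context riguet_congruence
begin

abbreviation Q :: "('o set, 'm set) cat" where
  "Q \<equiv> riguet_quotient C \<Phi>"

lemma Ob_quotient: "Ob Q = ob_class \<Phi> ` Ob C"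
  by (auto simp: riguet_quotient_def quotient_def ob_class_def)

lemma ob_class_eq_iff:
  assumes "a \<in> Ob C" "b \<in> Ob C"
  shows "ob_class \<Phi> a = ob_class \<Phi> b \<longleftrightarrow> (a, b) \<in> ob \<Phi>"
  using assms ob_equiv by (simp add: ob_class_def eq_equiv_class_iff)

lemma mem_ob_class: "a' \<in> ob_class \<Phi> a \<longleftrightarrow> (a, a') \<in> ob \<Phi>"
  by (simp add: ob_class_def)

lemma mem_fl_class_self:
  assumes "a \<in> Ob C" "b \<in> Ob C" "f \<in> Hom C a b"
  shows "f \<in> fl_class \<Phi> f"
  using fl_class_iff[OF assms] ob_refl fl_refl assms by blast

text \<open>
  An arrow between objects equivalent to \<open>a\<close> and \<open>b\<close> is congruent, by the lifting axiom, to one between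
  \<open>a\<close> and \<open>b\<close>; hence one hom-set of \<open>C\<close> already represents the whole hom-set of the quotient.
\<close>

lemma Hom_quotient:
  assumes a: "a \<in> Ob C" and b: "b \<in> Ob C"
  shows "Hom Q (ob_class \<Phi> a) (ob_class \<Phi> b) = fl_class \<Phi> ` Hom C a b"
proof (intro equalityI subsetI)
  fix X assume "X \<in> Hom Q (ob_class \<Phi> a) (ob_class \<Phi> b)"
  then obtain a' b' f where a': "(a, a') \<in> ob \<Phi>" and b': "(b, b') \<in> ob \<Phi>"
    and f: "f \<in> Hom C a' b'"
    and X: "X = fl_between \<Phi> (ob_class \<Phi> a) (ob_class \<Phi> b) `` {f}"
    by (auto simp: riguet_quotient_def quotient_def Hom_between_def mem_ob_class)
  note Obs = ob_Ob(2)[OF a'] ob_Ob(2)[OF b']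
  have "ob_class \<Phi> a = ob_class \<Phi> a'" "ob_class \<Phi> b = ob_class \<Phi> b'"
    using a b a' b' Obs by (simp_all add: ob_class_eq_iff)
  then have "X = fl_class \<Phi> f"
    using X fl_class_eq[OF Obs f] by simp
  moreover obtain f' where "f' \<in> Hom C a b" "(f, f') \<in> fl \<Phi> a' b' a b"
    using fl_lift[OF ob_sym[OF a'] ob_sym[OF b'] f] by blast
  ultimately show "X \<in> fl_class \<Phi> ` Hom C a b"
    using fl_class_eq_iff[OF Obs f a b] ob_sym[OF a'] ob_sym[OF b'] by blast
next
  fix X assume "X \<in> fl_class \<Phi> ` Hom C a b"
  then obtain f where f: "f \<in> Hom C a b" and X: "X = fl_class \<Phi> f"
    by blast
  have "f \<in> Hom_between C (ob_class \<Phi> a) (ob_class \<Phi> b)"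
    using f ob_refl[OF a] ob_refl[OF b] unfolding Hom_between_def
    by (blast intro: mem_ob_class[THEN iffD2])
  then show "X \<in> Hom Q (ob_class \<Phi> a) (ob_class \<Phi> b)"
    using X fl_class_eq[OF a b f] by (simp add: riguet_quotient_def quotientI)
qed

lemma Arr_quotient: "Arr Q = fl_class \<Phi> ` Arr C"
  by (force simp: Arr_def Ob_quotient Hom_quotient)

lemma Ident_quotient: "a \<in> Ob C \<Longrightarrow> Ident Q (ob_class \<Phi> a) = fl_class \<Phi> (Ident C a)"
  by (simp add: riguet_quotient_def quot_Ident_class)

text \<open>
  Once the target of \<open>f\<close> is the source of \<open>g\<close>, the intermediate arrow \<open>h\<close> congruent to \<open>f\<close> in the
  definition of the composite can be taken to be \<open>f\<close> itself.
\<close>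

lemma Comp_quotient:
  assumes "a \<in> Ob C" "b \<in> Ob C" "c \<in> Ob C" "f \<in> Hom C a b" "g \<in> Hom C b c"
  shows "Comp Q (fl_class \<Phi> g) (fl_class \<Phi> f) = fl_class \<Phi> (Comp C g f)"
  using quot_Comp_class[of a c b b f g f] assms ob_refl fl_refl by (simp add: riguet_quotient_def)

lemma category_quotient: "category Q"
proof
  fix A B A' B'
  assume "A \<in> Ob Q" "B \<in> Ob Q" "A' \<in> Ob Q" "B' \<in> Ob Q" and neq: "(A, B) \<noteq> (A', B')"
  then obtain a b a' b' where Obs: "a \<in> Ob C" "b \<in> Ob C" "a' \<in> Ob C" "b' \<in> Ob C"
    and eqs: "A = ob_class \<Phi> a" "B = ob_class \<Phi> b" "A' = ob_class \<Phi> a'" "B' = ob_class \<Phi> b'"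
    by (auto simp: Ob_quotient)
  \<comment> \<open>Congruent arrows have equivalent sources and equivalent targets.\<close>
  have "fl_class \<Phi> f \<noteq> fl_class \<Phi> f'" if "f \<in> Hom C a b" "f' \<in> Hom C a' b'" for f f'
    using neq that Obs by (auto simp: eqs fl_class_eq_iff ob_class_eq_iff)
  then show "Hom Q A B \<inter> Hom Q A' B' = {}"
    using Obs by (auto simp: eqs Hom_quotient)
next
  fix A assume "A \<in> Ob Q"
  then show "Ident Q A \<in> Hom Q A A"
    by (auto simp: Ob_quotient Hom_quotient Ident_quotient Ident_in_Hom)
next
  fix A B X assume "A \<in> Ob Q" "B \<in> Ob Q" "X \<in> Hom Q A B"
  then obtain a b f where "a \<in> Ob C" "b \<in> Ob C" "f \<in> Hom C a b"
    "A = ob_class \<Phi> a" "B = ob_class \<Phi> b" "X = fl_class \<Phi> f"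
    by (auto simp: Ob_quotient Hom_quotient)
  then show "Comp Q X (Ident Q A) = X" and "Comp Q (Ident Q B) X = X"
    using Comp_quotient[of a a b "Ident C a" f] Comp_quotient[of a b b f "Ident C b"]
    by (simp_all add: Ident_quotient Ident_in_Hom Comp_Ident Ident_Comp)
next
  fix A B D X Y
  assume "A \<in> Ob Q" "B \<in> Ob Q" "D \<in> Ob Q" "X \<in> Hom Q A B" "Y \<in> Hom Q B D"
  then show "Comp Q Y X \<in> Hom Q A D"
    by (auto simp: Ob_quotient Hom_quotient Comp_quotient intro!: imageI) (blast intro: Comp_in_Hom)
next
  fix A B D E X Y Z
  assume "A \<in> Ob Q" "B \<in> Ob Q" "D \<in> Ob Q" "E \<in> Ob Q"
    "X \<in> Hom Q A B" "Y \<in> Hom Q B D" "Z \<in> Hom Q D E"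
  then obtain a b d e f g h where *: "a \<in> Ob C" "b \<in> Ob C" "d \<in> Ob C" "e \<in> Ob C"
    "f \<in> Hom C a b" "g \<in> Hom C b d" "h \<in> Hom C d e"
    and eqs: "X = fl_class \<Phi> f" "Y = fl_class \<Phi> g" "Z = fl_class \<Phi> h"
    by (auto simp: Ob_quotient Hom_quotient)
  have "Comp C g f \<in> Hom C a d" "Comp C h g \<in> Hom C b e"
    using * Comp_in_Hom by blast+
  then show "Comp Q Z (Comp Q Y X) = Comp Q (Comp Q Z Y) X"
    using * Comp_quotient[of a b d f g] Comp_quotient[of a d e "Comp C g f" h]
      Comp_quotient[of b d e g h] Comp_quotient[of a b e f "Comp C h g"] Comp_assoc[of a b d e f g h]
    by (simp add: eqs)
qed

section \<open>Factorization through the projection\<close>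

text \<open>
  As \<open>F\<close> is extensional, the equation \<open>G \<circ> P = F\<close> says no more than which values \<open>G\<close> takes
  on the classes. In this form it serves both halves of the universal property: it is what to check
  for the induced functor, and it determines any other factorization.
\<close>

lemma functor_comp_proj_eq_iff:
  assumes "cat_functor C D F"
  shows "functor_comp C G (riguet_proj C \<Phi>) = F \<longleftrightarrow>
    (\<forall>a\<in>Ob C. onOb G (ob_class \<Phi> a) = onOb F a) \<and> (\<forall>f\<in>Arr C. onArr G (fl_class \<Phi> f) = onArr F f)"
proof -
  interpret F: cat_functor C D F by fact
  have "onOb F \<in> extensional (Ob C)"
    using F.onOb_funcset by (simp add: PiE_def)
  then have "compose (Ob C) (onOb G) (restrict (ob_class \<Phi>) (Ob C)) = onOb F \<longleftrightarrow>
      (\<forall>a\<in>Ob C. onOb G (ob_class \<Phi> a) = onOb F a)"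
    by (auto simp: compose_def fun_eq_iff extensional_def)
  moreover have "compose (Arr C) (onArr G) (restrict (fl_class \<Phi>) (Arr C)) = onArr F \<longleftrightarrow>
      (\<forall>f\<in>Arr C. onArr G (fl_class \<Phi> f) = onArr F f)"
    using F.onArr_extensional by (auto simp: compose_def fun_eq_iff extensional_def)
  ultimately show ?thesis
    by (cases F) (simp add: functor_comp_def riguet_proj_def)
qed

lemma proj_factorization_unique:
  assumes G: "cat_functor Q D G" and H: "cat_functor Q D H"
    and eq_Ob: "\<And>a. a \<in> Ob C \<Longrightarrow> onOb G (ob_class \<Phi> a) = onOb H (ob_class \<Phi> a)"
    and eq_Arr: "\<And>f. f \<in> Arr C \<Longrightarrow> onArr G (fl_class \<Phi> f) = onArr H (fl_class \<Phi> f)"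
  shows "G = H"
proof -
  interpret G: cat_functor Q D G by fact
  interpret H: cat_functor Q D H by fact
  have "onOb G = onOb H"
    by (rule PiE_ext[OF G.onOb_funcset H.onOb_funcset]) (auto simp: Ob_quotient eq_Ob)
  moreover have "onArr G = onArr H"
    by (rule extensionalityI[OF G.onArr_extensional H.onArr_extensional])
      (auto simp: Arr_quotient eq_Arr)
  ultimately show ?thesis by simp
qed

end

locale congruence_respecting_functor = riguet_congruence C \<Phi> + cat_functor C D F
  for C :: "('o1, 'm1) cat" and \<Phi> and D :: "('o2, 'm2) cat" and F +
  assumes onOb_cong: "(a, a') \<in> ob \<Phi> \<Longrightarrow> onOb F a = onOb F a'"
    and onArr_cong:
      "\<lbrakk>(a, a') \<in> ob \<Phi>; (b, b') \<in> ob \<Phi>; (f, f') \<in> fl \<Phi> a b a' b'\<rbrakk> \<Longrightarrow> onArr F f = onArr F f'"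
begin

text \<open>
  \<open>F\<close> is constant on each class, so the image of the class is a singleton, whose element is the
  induced value; this way no representative has to be chosen.
\<close>

definition induced :: "('o1 set, 'm1 set, 'o2, 'm2) cat_map" where
  "induced = \<lparr>onOb = \<lambda>A\<in>Ob Q. the_elem (onOb F ` A), onArr = \<lambda>X\<in>Arr Q. the_elem (onArr F ` X)\<rparr>"

lemma onOb_induced:
  assumes a: "a \<in> Ob C"
  shows "onOb induced (ob_class \<Phi> a) = onOb F a"
proof -
  have "onOb F a' = onOb F a" if "a' \<in> ob_class \<Phi> a" for a'
    using that onOb_cong by (auto simp: mem_ob_class)
  moreover have "a \<in> ob_class \<Phi> a"
    using ob_refl[OF a] by (simp add: mem_ob_class)
  ultimately have "onOb F ` ob_class \<Phi> a = {onOb F a}"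
    by blast
  then show ?thesis
    using a by (simp add: induced_def Ob_quotient)
qed

lemma onArr_induced:
  assumes f: "f \<in> Arr C"
  shows "onArr induced (fl_class \<Phi> f) = onArr F f"
proof -
  obtain a b where ab: "a \<in> Ob C" "b \<in> Ob C" "f \<in> Hom C a b"
    using f by (auto simp: Arr_def)
  have "onArr F f' = onArr F f" if "f' \<in> fl_class \<Phi> f" for f'
    using that onArr_cong[of a _ b _ f f'] unfolding fl_class_iff[OF ab] by auto
  then have "onArr F ` fl_class \<Phi> f = {onArr F f}"
    using mem_fl_class_self[OF ab] by blast
  then show ?thesis
    using f by (simp add: induced_def Arr_quotient)
qed

lemma cat_functor_induced: "cat_functor Q D induced"
proof -
  interpret Q: category Q by (rule category_quotient)
  have Arr_eq: "onArr induced (fl_class \<Phi> f) = onArr F f"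
    if "a \<in> Ob C" "b \<in> Ob C" "f \<in> Hom C a b" for a b f
    using onArr_induced[of f] that by (auto simp: Arr_def)
  show ?thesis
  proof unfold_locales
    have "onOb induced A \<in> Ob D" if "A \<in> Ob Q" for A
      using that onOb_funcset by (auto simp: Ob_quotient onOb_induced)
    then show "onOb induced \<in> Ob Q \<rightarrow>\<^sub>E Ob D"
      by (simp add: PiE_def Pi_def) (simp add: induced_def)
  next
    show "onArr induced \<in> extensional (Arr Q)"
      by (simp add: induced_def)
  next
    fix A B X assume "A \<in> Ob Q" "B \<in> Ob Q" "X \<in> Hom Q A B"
    then show "onArr induced X \<in> Hom D (onOb induced A) (onOb induced B)"
      by (auto simp: Ob_quotient Hom_quotient onOb_induced Arr_eq onArr_in_Hom)
  next
    fix A assume "A \<in> Ob Q"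
    then obtain a where a: "a \<in> Ob C" "A = ob_class \<Phi> a"
      by (auto simp: Ob_quotient)
    then show "onArr induced (Ident Q A) = Ident D (onOb induced A)"
      using Arr_eq[of a a "Ident C a"] Ident_in_Hom
      by (simp add: Ident_quotient onOb_induced onArr_Ident)
  next
    fix A B E X Y
    assume "A \<in> Ob Q" "B \<in> Ob Q" "E \<in> Ob Q" "X \<in> Hom Q A B" "Y \<in> Hom Q B E"
    then obtain a b e f g where *: "a \<in> Ob C" "b \<in> Ob C" "e \<in> Ob C"
      "f \<in> Hom C a b" "g \<in> Hom C b e" and eqs: "X = fl_class \<Phi> f" "Y = fl_class \<Phi> g"
      by (auto simp: Ob_quotient Hom_quotient)
    have "Comp C g f \<in> Hom C a e"
      using * Comp_in_Hom by blast
    then show "onArr induced (Comp Q Y X) = Comp D (onArr induced Y) (onArr induced X)"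
      using * Comp_quotient[of a b e f g] Arr_eq[of a b f] Arr_eq[of b e g] Arr_eq[of a e "Comp C g f"]
        onArr_Comp[of a b e f g]
      by (simp add: eqs)
  qed
qed

end

theorem proposition2p15:
  fixes C :: "('o1, 'm1) cat" and D :: "('o2, 'm2) cat"
    and \<Phi> :: "('o1, 'm1) cat_cong" and F :: "('o1, 'm1, 'o2, 'm2) cat_map"
  assumes "category C" and "category D"
    and "riguet_congruence C \<Phi>"
    and "cat_functor C D F"
    and "\<And>a a'. \<lbrakk>a \<in> Ob C; a' \<in> Ob C; (a, a') \<in> ob \<Phi>\<rbrakk> \<Longrightarrow> onOb F a = onOb F a'"
    and "\<And>a a' b b' f f'.
      \<lbrakk>(a, a') \<in> ob \<Phi>; (b, b') \<in> ob \<Phi>; f \<in> Hom C a b; f' \<in> Hom C a' b';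
        (f, f') \<in> fl \<Phi> a b a' b'\<rbrakk> \<Longrightarrow> onArr F f = onArr F f'"
  shows "\<exists>!G. cat_functor (riguet_quotient C \<Phi>) D G \<and>
    functor_comp C G (riguet_proj C \<Phi>) = F"
proof -
  interpret riguet_congruence C \<Phi> by fact
  interpret cat_functor C D F by fact
  interpret congruence_respecting_functor C \<Phi> D F
  proof
    show "onOb F a = onOb F a'" if "(a, a') \<in> ob \<Phi>" for a a'
      using assms(5) that ob_Ob by blast
    show "onArr F f = onArr F f'"
      if "(a, a') \<in> ob \<Phi>" "(b, b') \<in> ob \<Phi>" "(f, f') \<in> fl \<Phi> a b a' b'" for a a' b b' f f'
      using assms(6) that fl_subset by blast
  qed
  show ?thesis
  proof (rule ex1I)
    show "cat_functor Q D induced \<and> functor_comp C induced (riguet_proj C \<Phi>) = F"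
      using cat_functor_induced onOb_induced onArr_induced
      by (simp add: functor_comp_proj_eq_iff[OF assms(4)])
  next
    fix G assume "cat_functor Q D G \<and> functor_comp C G (riguet_proj C \<Phi>) = F"
    then show "G = induced"
      using proj_factorization_unique[of D G induced] cat_functor_induced onOb_induced onArr_induced
      by (simp add: functor_comp_proj_eq_iff[OF assms(4)])
  qed
qed

end
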